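(* Let $\vec{a}:\mathbb{R}^n\times\mathbb{R}\to\mathbb{R}^n$ be a $C^1$ vector field, let $f(y,t)$ be smooth for $y\in\Omega(t)$, let $T_0:\Omega_0\to\mathbb{R}$, and let $T(y,t)$ be a smooth function defined for $t\ge0$ and $y\in\overline{\Omega(t)}$. Assume that the flux is $$\vec{J}(y,t)=\vec{a}(y,t)\,T(y,t),\qquad y\in\Omega(t).$$ Then the balance problem in the moving domain $$\frac{\partial T}{\partial t}(y,t)+\operatorname{div}_y(T(y,t)\vec{V}(y))=f(y,t)-\operatorname{div}_y\vec{J},\ y\in\Omega(t);\quad T(y,t)=0,\ y\in\partial\Omega(t),\ \forall t;\quad T(y,0)=T_0(y),\ y\in\Omega_0$$ and its pulled-back form $$\frac{\partial\overline{T}}{\partial t}(x,t)+\overline{T}(x,t)\,\overline{\operatorname{div}\vec{V}}(x,t)=\overline{f}(x,t)-\overline{\operatorname{div}_y\vec{J}}(x,t),\ x\in\Omega_0;\quad \overline{T}(x,t)=0,\ x\in\partial\Omega_0,\ \forall t;\quad \overline{T}(x,0)=T_0(x),\ x\in\Omega_0$$ read, respectively, $$\frac{\partial T}{\partial t}(y,t)+\operatorname{div}_y(T(y,t)\vec{V}(y))+\nabla_yT(y,t)\cdot\vec{a}(y,t)+\operatorname{div}_y(\vec{a}(y,t))\,T(y,t)=f(y,t),\quad y\in\Omega(t),$$ with $T(y,t)=0$ for $y\in\partial\Omega(t)$ and all $t$, $T(y,0)=T_0(y)$ for $y\in\Omega_0$, and $$\frac{\partial\overline{T}}{\partial t}(x,t)+\overline{T}(x,t)\,C(x,t)+\nabla_x\overline{T}(x,t)\cdot\vec{b}(x,t)=\overline{f}(x,t),\quad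 x\in\Omega_0,$$ with $\overline{T}(x,t)=0$ for $x\in\partial\Omega_0$ and all $t$, $\overline{T}(x,0)=T_0(x)$ for $x\in\Omega_0$, where $$C(x,t)=\overline{\operatorname{div}_y\vec{V}}(x,t)+\overline{\operatorname{div}_y\vec{a}}(x,t),\qquad \vec{b}(x,t)=\big(D\psi(t)(y)\,\vec{a}(y,t)\big)\big|_{y=\phi(t)x}.$$ These two problems are equivalent: $T$ satisfies the first if and only if $\overline{T}$ satisfies the second.
   Context: $\Omega_0\subset\mathbb{R}^n$ is a smooth open set (domain). $\vec{V}:\mathbb{R}^n\to\mathbb{R}^n$ is a smooth vector field such that all solutions of the autonomous ODE $\dot Y=\vec{V}(Y)$ are defined for all $t\in\mathbb{R}$. For $t\in\mathbb{R}$, $\phi(t):\mathbb{R}^n\to\mathbb{R}^n$ is the flow map: $\phi(t)x=Y(t;x)$, where $Y(\cdot;x)$ is the solution with $Y(0;x)=x$; $\psi(t)=\phi(t)^{-1}=\phi(-t)$, and $D\psi(t)(y)$ is its Jacobian matrix at $y$. The moving domain is $\Omega(t)=\phi(t)\Omega_0$, with $\partial\Omega(t)=\phi(t)\partial\Omega_0$. For a function $g(y,t)$ defined for $y\in\Omega(t)$ (or its closure), the pulled-back function is $\overline{g}(x,t)=g(\phi(t)x,t)$. *)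

theory Defs
  imports "HOL-Analysis.Analysis"
begin

section \<open>Smoothness\<close>

text \<open>On an open set \<^term>\<open>S\<close> of a finite-dimensional space this says that \<^term>\<open>f\<close> is of
  class \<open>C\<^sup>k\<close>: iterated directional derivatives stand in for the iterated total derivative,
  whose codomain would change with the order.\<close>

fun higher_differentiable_on ::
  "'a::real_normed_vector set \<Rightarrow> ('a \<Rightarrow> 'b::real_normed_vector) \<Rightarrow> nat \<Rightarrow> bool" where
  "higher_differentiable_on S f 0 \<longleftrightarrow> continuous_on S f"
| "higher_differentiable_on S f (Suc k) \<longleftrightarrow>
     (\<forall>x\<in>S. f differentiable (at x)) \<and>
     (\<forall>v. higher_differentiable_on S (\<lambda>x. frechet_derivative f (at x) v) k)"

text \<open>Smoothness on a set that need not be open: near each of its points the function agrees, on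
  the set, with a smooth function of a full neighbourhood.  In particular only the values of
  \<^term>\<open>f\<close> on \<^term>\<open>S\<close> matter.\<close>

definition smooth_on ::
  "'a::euclidean_space set \<Rightarrow> ('a \<Rightarrow> 'b::real_normed_vector) \<Rightarrow> bool" where
  "smooth_on S f \<longleftrightarrow>
     (\<forall>p\<in>S. \<exists>U g. open U \<and> p \<in> U \<and> (\<forall>k. higher_differentiable_on U g k) \<and>
        (\<forall>q\<in>S \<inter> U. g q = f q))"

lemma higher_differentiable_on_subset:
  "higher_differentiable_on S f k \<Longrightarrow> T \<subseteq> S \<Longrightarrow> higher_differentiable_on T f k"
  by (induction k arbitrary: f) (auto intro: continuous_on_subset)

lemma higher_differentiable_on_cong:
  assumes "open S" "\<And>x. x \<in> S \<Longrightarrow> f x = g x" "higher_differentiable_on S f k"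
  shows "higher_differentiable_on S g k"
  using assms(2,3)
proof (induction k arbitrary: f g)
  case 0
  then show ?case by (simp cong: continuous_on_cong)
next
  case (Suc k)
  have der: "(f has_derivative D) (at x) \<longleftrightarrow> (g has_derivative D) (at x)" if "x \<in> S" for x D
    using has_derivative_transform_within_open[OF _ assms(1) that, of f D UNIV g]
      has_derivative_transform_within_open[OF _ assms(1) that, of g D UNIV f] Suc.prems(1)
    by auto
  then have "frechet_derivative f (at x) = frechet_derivative g (at x)" if "x \<in> S" for x
    using that by (simp add: frechet_derivative_def)
  moreover have "g differentiable (at x)" if "x \<in> S" for x
    using Suc.prems(2) that der[OF that] unfolding differentiable_def higher_differentiable_on.simps
    by blast
  ultimately show ?case
    using Suc.prems(2)
      Suc.IH[of "\<lambda>x. frechet_derivative f (at x) v" "\<lambda>x. frechet_derivative g (at x) v" for v]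
    by simp
qed

lemma higher_differentiable_on_local:
  assumes "\<And>x. x \<in> S \<Longrightarrow> \<exists>U. open U \<and> x \<in> U \<and> higher_differentiable_on U f k"
  shows "higher_differentiable_on S f k"
  using assms
proof (induction k arbitrary: f)
  case 0
  have "isCont f x" if x: "x \<in> S" for x
  proof -
    obtain U where "open U" "x \<in> U" "continuous_on U f"
      using 0[OF x] by auto
    then show ?thesis by (simp add: continuous_on_eq_continuous_at)
  qed
  then show ?case by (simp add: continuous_at_imp_continuous_on)
next
  case (Suc k)
  have "f differentiable (at x)" if "x \<in> S" for x
    using Suc.prems[OF that] by auto
  moreover have "higher_differentiable_on S (\<lambda>x. frechet_derivative f (at x) v) k" for v
  proof (rule Suc.IH)
    fix x assume "x \<in> S"
    from Suc.prems[OF this]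
    show "\<exists>U. open U \<and> x \<in> U \<and> higher_differentiable_on U (\<lambda>x. frechet_derivative f (at x) v) k"
      by auto
  qed
  ultimately show ?case by simp
qed

lemma smooth_on_open_iff:
  assumes "open S"
  shows "smooth_on S f \<longleftrightarrow> (\<forall>k. higher_differentiable_on S f k)"
proof
  assume smooth: "smooth_on S f"
  show "\<forall>k. higher_differentiable_on S f k"
  proof
    fix k
    show "higher_differentiable_on S f k"
    proof (rule higher_differentiable_on_local)
      fix x assume x: "x \<in> S"
      obtain U g where U: "open U" "x \<in> U" "higher_differentiable_on U g k"
        and eq: "\<forall>q\<in>S \<inter> U. g q = f q"
        using smooth x unfolding smooth_on_def by meson
      have "higher_differentiable_on (S \<inter> U) f k"
        using higher_differentiable_on_cong[of "S \<inter> U" g f k] assms U eq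
          higher_differentiable_on_subset[OF U(3), of "S \<inter> U"] by auto
      then show "\<exists>U. open U \<and> x \<in> U \<and> higher_differentiable_on U f k"
        using assms U x by blast
    qed
  qed
next
  assume "\<forall>k. higher_differentiable_on S f k"
  then show "smooth_on S f"
    using assms unfolding smooth_on_def by blast
qed


section \<open>Differential operators\<close>

definition gradient :: "(real^'n \<Rightarrow> real) \<Rightarrow> real^'n \<Rightarrow> real^'n" where
  "gradient g y = (\<chi> i. frechet_derivative g (at y) (axis i 1))"

definition divergence :: "(real^'n \<Rightarrow> real^'n) \<Rightarrow> real^'n \<Rightarrow> real" where
  "divergence F y = trace (jacobian F (at y))"

text \<open>Time runs over \<open>t \<ge> 0\<close>, so the time derivative is one-sided at \<open>t = 0\<close>.\<close>

definition time_derivative :: "(real^'n \<Rightarrow> real \<Rightarrow> real) \<Rightarrow> real^'n \<Rightarrow> real \<Rightarrow> real" where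
  "time_derivative g y t = vector_derivative (\<lambda>s. g y s) (at t within {0..})"


section \<open>The moving domain\<close>

text \<open>Near each boundary point the set is the sublevel set of a smooth function with nonzero
  gradient at that point, i.e. it lies locally on one side of a smooth hypersurface.\<close>

definition smooth_open_set :: "(real^'n) set \<Rightarrow> bool" where
  "smooth_open_set \<Omega> \<longleftrightarrow> open \<Omega> \<and>
     (\<forall>p\<in>frontier \<Omega>. \<exists>U g. open U \<and> p \<in> U \<and> smooth_on U g \<and> gradient g p \<noteq> 0 \<and>
        \<Omega> \<inter> U = {q \<in> U. g q < 0})"

text \<open>The flow of \<open>Y' = V(Y)\<close>.  Existence of such a \<^term>\<open>\<phi>\<close> expresses that all solutions are
  global; for smooth \<^term>\<open>V\<close> it is unique.\<close>

definition is_global_flow :: "(real^'n \<Rightarrow> real^'n) \<Rightarrow> (real \<Rightarrow> real^'n \<Rightarrow> real^'n) \<Rightarrow> bool" where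
  "is_global_flow V \<phi> \<longleftrightarrow>
     (\<forall>x. \<phi> 0 x = x \<and> (\<forall>t. ((\<lambda>s. \<phi> s x) has_vector_derivative V (\<phi> t x)) (at t)))"

definition moving_domain ::
  "(real \<Rightarrow> real^'n \<Rightarrow> real^'n) \<Rightarrow> (real^'n) set \<Rightarrow> real \<Rightarrow> (real^'n) set" where
  "moving_domain \<phi> \<Omega>\<^sub>0 t = \<phi> t ` \<Omega>\<^sub>0"

definition pullback ::
  "(real \<Rightarrow> real^'n \<Rightarrow> real^'n) \<Rightarrow> (real^'n \<Rightarrow> real \<Rightarrow> 'b) \<Rightarrow> real^'n \<Rightarrow> real \<Rightarrow> 'b" where
  "pullback \<phi> g x t = g (\<phi> t x) t"


section \<open>The four problems\<close>

definition balance_problem ::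
  "(real \<Rightarrow> real^'n \<Rightarrow> real^'n) \<Rightarrow> (real^'n) set \<Rightarrow> (real^'n \<Rightarrow> real^'n) \<Rightarrow>
   (real^'n \<Rightarrow> real \<Rightarrow> real) \<Rightarrow> (real^'n \<Rightarrow> real \<Rightarrow> real^'n) \<Rightarrow> (real^'n \<Rightarrow> real) \<Rightarrow>
   (real^'n \<Rightarrow> real \<Rightarrow> real) \<Rightarrow> bool" where
  "balance_problem \<phi> \<Omega>\<^sub>0 V f J T\<^sub>0 T \<longleftrightarrow>
     (\<forall>t\<ge>0. \<forall>y\<in>moving_domain \<phi> \<Omega>\<^sub>0 t.
        time_derivative T y t + divergence (\<lambda>z. T z t *\<^sub>R V z) y
          = f y t - divergence (\<lambda>z. J z t) y) \<and>
     (\<forall>t\<ge>0. \<forall>y\<in>frontier (moving_domain \<phi> \<Omega>\<^sub>0 t). T y t = 0) \<and>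
     (\<forall>y\<in>\<Omega>\<^sub>0. T y 0 = T\<^sub>0 y)"

definition pulled_back_balance_problem ::
  "(real \<Rightarrow> real^'n \<Rightarrow> real^'n) \<Rightarrow> (real^'n) set \<Rightarrow> (real^'n \<Rightarrow> real^'n) \<Rightarrow>
   (real^'n \<Rightarrow> real \<Rightarrow> real) \<Rightarrow> (real^'n \<Rightarrow> real \<Rightarrow> real^'n) \<Rightarrow> (real^'n \<Rightarrow> real) \<Rightarrow>
   (real^'n \<Rightarrow> real \<Rightarrow> real) \<Rightarrow> bool" where
  "pulled_back_balance_problem \<phi> \<Omega>\<^sub>0 V f J T\<^sub>0 U \<longleftrightarrow>
     (\<forall>t\<ge>0. \<forall>x\<in>\<Omega>\<^sub>0.
        time_derivative U x t
          + U x t * pullback \<phi> (\<lambda>y s. divergence V y) x t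
          = pullback \<phi> f x t - pullback \<phi> (\<lambda>y s. divergence (\<lambda>z. J z s) y) x t) \<and>
     (\<forall>t\<ge>0. \<forall>x\<in>frontier \<Omega>\<^sub>0. U x t = 0) \<and>
     (\<forall>x\<in>\<Omega>\<^sub>0. U x 0 = T\<^sub>0 x)"

definition advection_problem ::
  "(real \<Rightarrow> real^'n \<Rightarrow> real^'n) \<Rightarrow> (real^'n) set \<Rightarrow> (real^'n \<Rightarrow> real^'n) \<Rightarrow>
   (real^'n \<Rightarrow> real \<Rightarrow> real) \<Rightarrow> (real^'n \<Rightarrow> real \<Rightarrow> real^'n) \<Rightarrow> (real^'n \<Rightarrow> real) \<Rightarrow>
   (real^'n \<Rightarrow> real \<Rightarrow> real) \<Rightarrow> bool" where
  "advection_problem \<phi> \<Omega>\<^sub>0 V f a T\<^sub>0 T \<longleftrightarrow>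
     (\<forall>t\<ge>0. \<forall>y\<in>moving_domain \<phi> \<Omega>\<^sub>0 t.
        time_derivative T y t + divergence (\<lambda>z. T z t *\<^sub>R V z) y
          + gradient (\<lambda>z. T z t) y \<bullet> a y t + divergence (\<lambda>z. a z t) y * T y t = f y t) \<and>
     (\<forall>t\<ge>0. \<forall>y\<in>frontier (moving_domain \<phi> \<Omega>\<^sub>0 t). T y t = 0) \<and>
     (\<forall>y\<in>\<Omega>\<^sub>0. T y 0 = T\<^sub>0 y)"

definition reaction_coefficient ::
  "(real \<Rightarrow> real^'n \<Rightarrow> real^'n) \<Rightarrow> (real^'n \<Rightarrow> real^'n) \<Rightarrow> (real^'n \<Rightarrow> real \<Rightarrow> real^'n) \<Rightarrow>
   real^'n \<Rightarrow> real \<Rightarrow> real" where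
  "reaction_coefficient \<phi> V a x t =
     pullback \<phi> (\<lambda>y s. divergence V y) x t
     + pullback \<phi> (\<lambda>y s. divergence (\<lambda>z. a z s) y) x t"

definition pulled_back_velocity ::
  "(real \<Rightarrow> real^'n \<Rightarrow> real^'n) \<Rightarrow> (real^'n \<Rightarrow> real \<Rightarrow> real^'n) \<Rightarrow> real^'n \<Rightarrow> real \<Rightarrow> real^'n" where
  "pulled_back_velocity \<phi> a x t =
     pullback \<phi> (\<lambda>y s. jacobian (inv (\<phi> s)) (at y) *v a y s) x t"

definition pulled_back_advection_problem ::
  "(real \<Rightarrow> real^'n \<Rightarrow> real^'n) \<Rightarrow> (real^'n) set \<Rightarrow> (real^'n \<Rightarrow> real^'n) \<Rightarrow>
   (real^'n \<Rightarrow> real \<Rightarrow> real) \<Rightarrow> (real^'n \<Rightarrow> real \<Rightarrow> real^'n) \<Rightarrow> (real^'n \<Rightarrow> real) \<Rightarrow>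
   (real^'n \<Rightarrow> real \<Rightarrow> real) \<Rightarrow> bool" where
  "pulled_back_advection_problem \<phi> \<Omega>\<^sub>0 V f a T\<^sub>0 U \<longleftrightarrow>
     (\<forall>t\<ge>0. \<forall>x\<in>\<Omega>\<^sub>0.
        time_derivative U x t
          + U x t * reaction_coefficient \<phi> V a x t
          + gradient (\<lambda>z. U z t) x \<bullet> pulled_back_velocity \<phi> a x t
          = pullback \<phi> f x t) \<and>
     (\<forall>t\<ge>0. \<forall>x\<in>frontier \<Omega>\<^sub>0. U x t = 0) \<and>
     (\<forall>x\<in>\<Omega>\<^sub>0. U x 0 = T\<^sub>0 x)"

end

theory Submission
  imports Defs
begin

text \<open>The balance and the advection form differ by the product rule for \<open>div (T a)\<close>.  The moving and the
  pulled-back problem agree because the time derivative of \<open>T (\<phi> t x) t\<close> is the material derivative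
  \<open>\<partial>\<^sub>t T + \<nabla>T \<bullet> V\<close>, and because the chain rule through the diffeomorphism \<open>\<phi> t\<close> turns \<open>\<nabla>T \<bullet> a\<close> into
  \<open>\<nabla>(T \<circ> \<phi> t) \<bullet> D\<psi> a\<close>.  The analytic core is the differentiability of the flow in its initial value.
  Rather than solving the variational equation, one shows by Gronwall that the increment
  \<open>\<phi> t (x + h) - \<phi> t x\<close> is linear in \<open>h\<close> up to an error \<open>o(\<bar>h\<bar>)\<close>; this already forces the difference
  quotients to converge to a linear map.  Negative times follow by reversing the field.\<close>

section \<open>Gronwall estimates\<close>

text \<open>The norm is not differentiable at zero, so the estimate runs on
  \<open>u = |E|^2 + \<eta>^2\<close>. Cauchy-Schwarz and
  \<open>2 \<eta> |E| \<le> \<eta>^2 + |E|^2\<close> give \<open>u' \<le> (2 K + 2) u\<close>;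
  taking the square root at the end produces the rate \<open>K + 1\<close>.\<close>

lemma gronwall_norm:
  fixes E :: "real \<Rightarrow> 'a::euclidean_space"
  assumes der: "\<And>s. (E has_vector_derivative E' s) (at s)"
    and bound: "\<And>s. 0 < s \<Longrightarrow> s < t \<Longrightarrow> norm (E' s) \<le> K * norm (E s) + \<eta>"
    and "0 \<le> K" "0 \<le> \<eta>" "0 \<le> t"
  shows "norm (E t) \<le> (norm (E 0) + \<eta>) * exp ((K + 1) * t)"
proof -
  define u where "u s = (norm (E s))\<^sup>2 + \<eta>\<^sup>2" for s
  \<comment> \<open>Integrating factor: \<open>u' \<le> (2 K + 2) u\<close> says that
    \<open>w\<close> does not increase.\<close>
  define w where "w s = u s * exp (- ((2 * K + 2) * s))" for s
  have u_der: "(u has_real_derivative 2 * (E s \<bullet> E' s)) (at s)" for s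
  proof -
    have "((\<lambda>s. E s \<bullet> E s + \<eta>\<^sup>2) has_real_derivative 2 * (E s \<bullet> E' s)) (at s)"
      using der[of s] unfolding has_vector_derivative_def has_field_derivative_def
      by (auto intro!: derivative_eq_intros simp: inner_commute)
    then show ?thesis by (simp add: u_def[abs_def] power2_norm_eq_inner)
  qed
  have w_der: "(w has_real_derivative
      (2 * (E s \<bullet> E' s) - (2 * K + 2) * u s) * exp (- ((2 * K + 2) * s))) (at s)" for s
    unfolding w_def[abs_def]
    by (rule derivative_eq_intros u_der refl)+ (simp add: algebra_simps)
  have "w t \<le> w 0"
  proof (rule DERIV_nonpos_imp_decreasing_open[OF \<open>0 \<le> t\<close>])
    show "continuous_on {0..t} w"
      by (rule DERIV_continuous_on, rule has_field_derivative_at_within, rule w_der)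
    fix s assume s: "0 < s" "s < t"
    have "E s \<bullet> E' s \<le> norm (E s) * norm (E' s)"
      by (rule norm_cauchy_schwarz)
    also have "\<dots> \<le> norm (E s) * (K * norm (E s) + \<eta>)"
      by (intro mult_left_mono bound s) simp
    finally have "2 * (E s \<bullet> E' s) \<le> 2 * K * (norm (E s))\<^sup>2 + 2 * \<eta> * norm (E s)"
      by (simp add: algebra_simps power2_eq_square)
    moreover have "2 * \<eta> * norm (E s) \<le> \<eta>\<^sup>2 + (norm (E s))\<^sup>2"
      using sum_squares_bound[of \<eta> "norm (E s)"] by simp
    moreover have "0 \<le> K * \<eta>\<^sup>2" using \<open>0 \<le> K\<close> by simp
    ultimately have "2 * (E s \<bullet> E' s) \<le> (2 * K + 2) * u s"
      using zero_le_power2[of \<eta>] zero_le_power2[of "norm (E s)"]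
      unfolding u_def distrib_left distrib_right by linarith
    then show "\<exists>y. DERIV w s :> y \<and> y \<le> 0"
      using w_der[of s] by (force simp: mult_nonpos_nonneg)
  qed
  then have "w t * exp ((2 * K + 2) * t) \<le> w 0 * exp ((2 * K + 2) * t)"
    by (intro mult_right_mono) auto
  then have "u t \<le> u 0 * exp ((2 * K + 2) * t)"
    by (simp add: w_def mult.assoc flip: exp_add)
  also have "exp ((2 * K + 2) * t) = (exp ((K + 1) * t))\<^sup>2"
    by (simp add: power2_eq_square algebra_simps flip: exp_add)
  also have "u 0 \<le> (norm (E 0) + \<eta>)\<^sup>2"
    using \<open>0 \<le> \<eta>\<close> by (simp add: u_def power2_sum)
  finally have "u t \<le> ((norm (E 0) + \<eta>) * exp ((K + 1) * t))\<^sup>2"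
    by (simp add: power_mult_distrib)
  then have "(norm (E t))\<^sup>2 \<le> ((norm (E 0) + \<eta>) * exp ((K + 1) * t))\<^sup>2"
    by (smt (verit) u_def zero_le_power2)
  then show ?thesis
    using \<open>0 \<le> \<eta>\<close> by (simp add: abs_le_square_iff[symmetric])
qed

text \<open>A continuity argument: the bound on \<open>E'\<close> is available only while
  \<open>E\<close> stays below \<open>\<delta>\<close>, but up to a first exit time Gronwall applies
  with \<open>\<eta> = 0\<close>, and the smallness of \<open>E 0\<close> keeps the resulting bound
  strictly below \<open>\<delta>\<close>. So there is no exit.\<close>

lemma gronwall_norm_in_tube:
  fixes E :: "real \<Rightarrow> 'a::euclidean_space"
  assumes der: "\<And>s. (E has_vector_derivative E' s) (at s)"
    and bound: "\<And>s. 0 \<le> s \<Longrightarrow> s \<le> t \<Longrightarrow> norm (E s) < \<delta> \<Longrightarrow> norm (E' s) \<le> K * norm (E s)"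
    and small: "norm (E 0) * exp ((K + 1) * t) < \<delta>"
    and "0 \<le> K" "0 \<le> s" "s \<le> t"
  shows "norm (E s) \<le> norm (E 0) * exp ((K + 1) * s)"
proof -
  have cont: "continuous_on S E" for S
    by (intro continuous_at_imp_continuous_on ballI has_vector_derivative_continuous[OF der])
  have mono: "norm (E 0) * exp ((K + 1) * r) < \<delta>" if "r \<le> t" for r
  proof -
    have "norm (E 0) * exp ((K + 1) * r) \<le> norm (E 0) * exp ((K + 1) * t)"
      using that \<open>0 \<le> K\<close> by (intro mult_left_mono) auto
    then show ?thesis using small by simp
  qed
  \<comment> \<open>Only strictly earlier times must lie in the tube, so this also covers the exit
    time itself.\<close>
  have est: "norm (E r) \<le> norm (E 0) * exp ((K + 1) * r)"
    if "0 \<le> r" "r \<le> t" "\<And>q. 0 < q \<Longrightarrow> q < r \<Longrightarrow> norm (E q) < \<delta>" for r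
    using gronwall_norm[OF der, of r K 0] bound that \<open>0 \<le> K\<close> by simp
  have inside: "norm (E r) < \<delta>" if r: "0 \<le> r" "r \<le> t" for r
  proof (rule ccontr)
    assume "\<not> norm (E r) < \<delta>"
    \<comment> \<open>The minimum of this compact set of bad times is the first exit time.\<close>
    define B where "B = {0..t} \<inter> (\<lambda>q. norm (E q)) -` {\<delta>..}"
    have "r \<in> B" using r \<open>\<not> norm (E r) < \<delta>\<close> by (simp add: B_def)
    moreover have "closed B"
      unfolding B_def by (intro continuous_closed_preimage continuous_intros cont)
    moreover have "bounded B"
      unfolding B_def by (rule bounded_subset[of "{0..t}"]) auto
    ultimately obtain m where m: "m \<in> B" "\<And>q. q \<in> B \<Longrightarrow> m \<le> q"
      using compact_attains_inf[of B] compact_eq_bounded_closed by blast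
    have "norm (E m) \<le> norm (E 0) * exp ((K + 1) * m)"
    proof (rule est)
      fix q assume q: "0 < q" "q < m"
      then have "q \<notin> B" using m(2)[of q] by auto
      then show "norm (E q) < \<delta>"
        using q m(1) by (auto simp: B_def)
    qed (use m(1) in \<open>auto simp: B_def\<close>)
    then show False using m(1) mono[of m] by (auto simp: B_def)
  qed
  show ?thesis by (rule est) (use inside \<open>0 \<le> s\<close> \<open>s \<le> t\<close> in auto)
qed

text \<open>By compactness \<open>A\<close> is uniformly continuous on the closed unit neighbourhood
  of \<open>C\<close>, so it varies by less than \<open>\<epsilon>\<close> over balls of one common
  radius; the mean value inequality turns this into the linearization error.\<close>

lemma uniform_linearization_on_compact:
  fixes V :: "'a::euclidean_space \<Rightarrow> 'a" and A :: "'a \<Rightarrow> 'a \<Rightarrow>\<^sub>L 'a"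
  assumes der: "\<And>x. (V has_derivative A x) (at x)"
    and cont: "continuous_on UNIV A"
    and "compact C" "0 < \<epsilon>"
  obtains \<delta> where "0 < \<delta>"
    "\<And>p z. p \<in> C \<Longrightarrow> norm z < \<delta> \<Longrightarrow> norm (V (p + z) - V p - A p z) \<le> \<epsilon> * norm z"
proof -
  define C' where "C' = (\<Union>x\<in>C. \<Union>y\<in>cball 0 1. {x + y})"
  have "compact C'"
    unfolding C'_def by (rule compact_sums'[OF \<open>compact C\<close>]) simp
  then have "uniformly_continuous_on C' A"
    by (intro compact_uniformly_continuous continuous_on_subset[OF cont]) auto
  then obtain d where d: "0 < d"
    "\<And>p q. p \<in> C' \<Longrightarrow> q \<in> C' \<Longrightarrow> dist q p < d \<Longrightarrow> dist (A q) (A p) < \<epsilon>"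
    unfolding uniformly_continuous_on_def using \<open>0 < \<epsilon>\<close> by metis
  show ?thesis
  proof
    \<comment> \<open>The cap 1 keeps the ball around \<open>p\<close> inside \<open>C'\<close>,
      where \<open>d\<close> controls \<open>A\<close>.\<close>
    show "0 < min d 1" using d by simp
    fix p z :: 'a assume p: "p \<in> C" and z: "norm z < min d 1"
    define S where "S = ball p (min d 1)"
    have "norm (V (p + z) - V p - A p ((p + z) - p)) \<le> norm ((p + z) - p) * \<epsilon>"
    proof (rule differentiable_bound_linearization[where S = S and f' = "\<lambda>x. blinfun_apply (A x)"
            and ?x0.0 = p])
      fix r :: real assume "r \<in> {0..1}"
      then have "norm (r *\<^sub>R z) < min d 1"
        using z mult_left_le_one_le[of "norm z" "\<bar>r\<bar>"] by auto
      then show "p + r *\<^sub>R (p + z - p) \<in> S" by (simp add: S_def dist_norm)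
    next
      fix x assume "x \<in> S"
      then have x: "norm (x - p) < d" "norm (x - p) < 1"
        by (auto simp: S_def dist_norm norm_minus_commute)
      have "\<exists>y\<in>cball 0 1. x = p + y"
        using x(2) by (intro bexI[of _ "x - p"]) auto
      moreover have "\<exists>y\<in>cball 0 1. p = p + y"
        by (intro bexI[of _ 0]) auto
      ultimately have "x \<in> C'" "p \<in> C'"
        using p unfolding C'_def by blast+
      then have "dist (A x) (A p) < \<epsilon>" using d(2)[of p x] x by (simp add: dist_norm)
      then show "onorm (blinfun_apply (A x) - blinfun_apply (A p)) \<le> \<epsilon>"
        by (simp add: dist_norm norm_blinfun.rep_eq minus_blinfun.rep_eq fun_diff_def)
      show "(V has_derivative blinfun_apply (A x)) (at x within S)"
        by (rule has_derivative_at_withinI[OF der])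
    qed (use d in \<open>auto simp: S_def\<close>)
    then show "norm (V (p + z) - V p - A p z) \<le> \<epsilon> * norm z"
      by (simp add: mult.commute)
  qed
qed

text \<open>In finite dimension, continuity of every directional derivative amounts to continuity in
  operator norm, the form that the estimates use.\<close>

lemma smooth_on_UNIV_imp_C1:
  fixes V :: "'a::euclidean_space \<Rightarrow> 'b::euclidean_space"
  assumes "smooth_on UNIV V"
  obtains A :: "'a \<Rightarrow> 'a \<Rightarrow>\<^sub>L 'b"
  where "\<And>x. (V has_derivative A x) (at x)" "continuous_on UNIV A"
proof -
  have "higher_differentiable_on UNIV V (Suc 0)"
    using assms smooth_on_open_iff by blast
  then have diff: "V differentiable (at x)"
    and cont: "continuous_on UNIV (\<lambda>x. frechet_derivative V (at x) v)" for x v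
    by auto
  define A where "A x = Blinfun (frechet_derivative V (at x))" for x
  have A: "blinfun_apply (A x) = frechet_derivative V (at x)" for x
    using diff[of x] unfolding A_def frechet_derivative_works
    by (intro bounded_linear_Blinfun_apply has_derivative_bounded_linear)
  show ?thesis
  proof
    show "(V has_derivative A x) (at x)" for x
      using diff by (simp add: A frechet_derivative_works)
    show "continuous_on UNIV A"
      by (rule continuous_on_blinfun_componentwise) (simp add: A cont)
  qed
qed

section \<open>Solutions of an autonomous equation with a continuously differentiable field\<close>

definition solution :: "('a::real_normed_vector \<Rightarrow> 'a) \<Rightarrow> (real \<Rightarrow> 'a) \<Rightarrow> bool" where
  "solution V Y \<longleftrightarrow> (\<forall>t. (Y has_vector_derivative V (Y t)) (at t))"

lemma solution_continuous: "solution V Y \<Longrightarrow> continuous_on S Y"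
  unfolding solution_def
  by (intro continuous_at_imp_continuous_on ballI) (metis has_vector_derivative_continuous)

lemma solution_shift:
  assumes "solution V Y" shows "solution V (\<lambda>s. Y (s + r))"
  unfolding solution_def
proof
  fix t
  have "(Y has_vector_derivative V (Y (t + r))) (at (t + r))"
    using assms by (simp add: solution_def)
  then show "((\<lambda>s. Y (s + r)) has_vector_derivative V (Y (t + r))) (at t)"
    using vector_diff_chain_at[of "\<lambda>s. s + r" 1 t Y "V (Y (t + r))"]
    by (simp add: o_def has_vector_derivative_add_const has_vector_derivative_id)
qed

lemma solution_reverse:
  assumes "solution V Y" shows "solution (\<lambda>x. - V x) (\<lambda>s. Y (- s))"
  unfolding solution_def
proof
  fix t
  have "(Y has_vector_derivative V (Y (- t))) (at (- t))"
    using assms by (simp add: solution_def)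
  moreover have "((\<lambda>s. - s) has_vector_derivative (- 1 :: real)) (at t)"
    by (intro derivative_intros)
  ultimately show "((\<lambda>s. Y (- s)) has_vector_derivative - V (Y (- t))) (at t)"
    using vector_diff_chain_at[of "\<lambda>s. - s" "- 1" t Y "V (Y (- t))"] by (simp add: o_def)
qed

text \<open>The field is a parameter so that the locale can be reused for \<open>- V\<close>: the
  estimates run forward in time only.\<close>

locale C1_field =
  fixes V :: "'a::euclidean_space \<Rightarrow> 'a" and A :: "'a \<Rightarrow> 'a \<Rightarrow>\<^sub>L 'a"
  assumes field_derivative: "(V has_derivative A x) (at x)"
    and field_C1: "continuous_on UNIV A"
begin

lemma reverse: "C1_field (\<lambda>x. - V x) (\<lambda>x. - A x)"
  by unfold_locales
    (auto intro!: continuous_intros field_C1 has_derivative_minus field_derivative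
      simp: uminus_blinfun.rep_eq)

lemma tube_linearization:
  assumes Y: "solution V Y" and "0 < \<epsilon>"
  obtains \<delta> where "0 < \<delta>"
    "\<And>s z. 0 \<le> s \<Longrightarrow> s \<le> t \<Longrightarrow> norm (z - Y s) < \<delta> \<Longrightarrow>
      norm (V z - V (Y s) - A (Y s) (z - Y s)) \<le> \<epsilon> * norm (z - Y s)"
proof -
  have "compact (Y ` {0..t})"
    by (intro compact_continuous_image solution_continuous[OF Y]) simp
  then obtain \<delta> where "0 < \<delta>"
    and \<delta>: "\<And>p z. p \<in> Y ` {0..t} \<Longrightarrow> norm z < \<delta> \<Longrightarrow>
      norm (V (p + z) - V p - A p z) \<le> \<epsilon> * norm z"
    using uniform_linearization_on_compact[OF field_derivative field_C1 _ \<open>0 < \<epsilon>\<close>] by metis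
  show ?thesis
  proof
    fix s z assume "0 \<le> s" "s \<le> t" "norm (z - Y s) < \<delta>"
    then show "norm (V z - V (Y s) - A (Y s) (z - Y s)) \<le> \<epsilon> * norm (z - Y s)"
      using \<delta>[of "Y s" "z - Y s"] by simp
  qed fact
qed

lemma derivative_bounded_along_solution:
  assumes Y: "solution V Y"
  obtains K where "0 \<le> K"
    "\<And>s v. 0 \<le> s \<Longrightarrow> s \<le> t \<Longrightarrow> norm (A (Y s) v) \<le> K * norm v"
proof -
  have "compact ((\<lambda>s. A (Y s)) ` {0..t})"
    by (intro compact_continuous_image continuous_on_compose2[OF field_C1 solution_continuous[OF Y]])
      auto
  then obtain K where K: "0 < K" "\<And>s. s \<in> {0..t} \<Longrightarrow> norm (A (Y s)) \<le> K"
    using compact_imp_bounded bounded_pos by (metis image_eqI)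
  show ?thesis
  proof
    show "0 \<le> K" using K by simp
    fix s v assume "0 \<le> s" "s \<le> t"
    then show "norm (A (Y s) v) \<le> K * norm v"
      using K(2)[of s] norm_blinfun[of "A (Y s)" v]
      by (smt (verit, best) atLeastAtMost_iff mult_right_mono norm_ge_zero)
  qed
qed

text \<open>The field is only locally Lipschitz. Near the compact piece of trajectory, the bound
  \<open>K\<close> on the derivative and a linearization error 1 give the constant
  \<open>K + 1\<close> relative to \<open>Y\<close>, and the tube form of Gronwall confines nearby
  solutions to that region.\<close>

lemma stability:
  assumes Y: "solution V Y" and "0 \<le> t"
  obtains \<delta> L where "0 < \<delta>" "0 < L"
    "\<And>Z s. solution V Z \<Longrightarrow> norm (Z 0 - Y 0) < \<delta> \<Longrightarrow> 0 \<le> s \<Longrightarrow> s \<le> t \<Longrightarrow>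
      norm (Z s - Y s) \<le> L * norm (Z 0 - Y 0)"
proof -
  obtain K where K: "0 \<le> K" "\<And>s v. 0 \<le> s \<Longrightarrow> s \<le> t \<Longrightarrow> norm (A (Y s) v) \<le> K * norm v"
    using derivative_bounded_along_solution[OF Y] by blast
  obtain d where "0 < d" and d: "\<And>s z. 0 \<le> s \<Longrightarrow> s \<le> t \<Longrightarrow> norm (z - Y s) < d \<Longrightarrow>
      norm (V z - V (Y s) - A (Y s) (z - Y s)) \<le> 1 * norm (z - Y s)"
    using tube_linearization[OF Y zero_less_one] by blast
  \<comment> \<open>The first 1 is the linearization error, the second the loss in Gronwall. Initial
    distance below \<open>d / L\<close> then keeps solutions in the tube.\<close>
  define L where "L = exp ((K + 1 + 1) * t)"
  show ?thesis
  proof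
    show "0 < d / L" "0 < L" using \<open>0 < d\<close> by (auto simp: L_def)
    fix Z s assume Z: "solution V Z" and close: "norm (Z 0 - Y 0) < d / L" and s: "0 \<le> s" "s \<le> t"
    have "norm (Z s - Y s) \<le> norm (Z 0 - Y 0) * exp ((K + 1 + 1) * s)"
    proof (rule gronwall_norm_in_tube[where E = "\<lambda>s. Z s - Y s"
          and E' = "\<lambda>s. V (Z s) - V (Y s)" and K = "K + 1" and t = t and \<delta> = d])
      show "((\<lambda>s. Z s - Y s) has_vector_derivative V (Z s) - V (Y s)) (at s)" for s
        using Y Z by (auto simp: solution_def intro: has_vector_derivative_diff)
      show "norm (Z 0 - Y 0) * exp ((K + 1 + 1) * t) < d"
        using close by (simp add: L_def field_simps)
      fix r assume r: "0 \<le> r" "r \<le> t" "norm (Z r - Y r) < d"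
      show "norm (V (Z r) - V (Y r)) \<le> (K + 1) * norm (Z r - Y r)"
        using d[OF r] K(2)[OF r(1,2), of "Z r - Y r"]
          norm_triangle_sub[of "V (Z r) - V (Y r)" "A (Y r) (Z r - Y r)"]
        by (simp add: algebra_simps)
    qed (use K s in auto)
    also have "\<dots> \<le> norm (Z 0 - Y 0) * L"
      unfolding L_def using K s by (intro mult_left_mono) auto
    finally show "norm (Z s - Y s) \<le> L * norm (Z 0 - Y 0)" by (simp add: mult.commute)
  qed
qed

lemma solution_unique_forward:
  assumes "solution V Y" "solution V Z" "Y 0 = Z 0" "0 \<le> t"
  shows "Y t = Z t"
proof -
  obtain \<delta> L where "0 < \<delta>" "0 < L"
    and st: "\<And>Z s. solution V Z \<Longrightarrow> norm (Z 0 - Y 0) < \<delta> \<Longrightarrow> 0 \<le> s \<Longrightarrow> s \<le> t \<Longrightarrow>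
      norm (Z s - Y s) \<le> L * norm (Z 0 - Y 0)"
    using stability[OF assms(1,4)] by blast
  show ?thesis using st[of Z t] assms \<open>0 < \<delta>\<close> by simp
qed

text \<open>The deviation from \<^term>\<open>Y\<close> solves the variational equation up to an error
  \<open>o(\<bar>h\<bar>)\<close>, so by Gronwall it depends on its initial value linearly up to such an error.\<close>

lemma deviation_almost_linear:
  assumes Y: "solution V Y" and "0 \<le> t" "0 < \<epsilon>"
  obtains \<delta> where "0 < \<delta>"
    "\<And>Z1 Z2 Z3 c. solution V Z1 \<Longrightarrow> solution V Z2 \<Longrightarrow> solution V Z3 \<Longrightarrow>
      norm (Z1 0 - Y 0) < \<delta> \<Longrightarrow> norm (Z2 0 - Y 0) < \<delta> \<Longrightarrow> norm (Z3 0 - Y 0) < \<delta> \<Longrightarrow>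
      Z1 0 - Y 0 = c *\<^sub>R (Z2 0 - Y 0) + (Z3 0 - Y 0) \<Longrightarrow>
      norm ((Z1 t - Y t) - (c *\<^sub>R (Z2 t - Y t) + (Z3 t - Y t)))
        \<le> \<epsilon> * (norm (Z1 0 - Y 0) + \<bar>c\<bar> * norm (Z2 0 - Y 0) + norm (Z3 0 - Y 0))"
proof -
  obtain K where K: "0 \<le> K" "\<And>s v. 0 \<le> s \<Longrightarrow> s \<le> t \<Longrightarrow> norm (A (Y s) v) \<le> K * norm v"
    using derivative_bounded_along_solution[OF Y] by blast
  obtain d L where "0 < d" "0 < L"
    and st: "\<And>Z s. solution V Z \<Longrightarrow> norm (Z 0 - Y 0) < d \<Longrightarrow> 0 \<le> s \<Longrightarrow> s \<le> t \<Longrightarrow>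
      norm (Z s - Y s) \<le> L * norm (Z 0 - Y 0)"
    using stability[OF Y \<open>0 \<le> t\<close>] by blast
  \<comment> \<open>Chosen so that the stability factor \<open>L\<close> and the Gronwall
    exponential cancel and leave \<open>\<epsilon>\<close>.\<close>
  define \<epsilon>' where "\<epsilon>' = \<epsilon> / (L * exp ((K + 1) * t))"
  have "0 < \<epsilon>'" using \<open>0 < L\<close> \<open>0 < \<epsilon>\<close> by (simp add: \<epsilon>'_def)
  obtain e where "0 < e" and e: "\<And>s z. 0 \<le> s \<Longrightarrow> s \<le> t \<Longrightarrow> norm (z - Y s) < e \<Longrightarrow>
      norm (V z - V (Y s) - A (Y s) (z - Y s)) \<le> \<epsilon>' * norm (z - Y s)"
    using tube_linearization[OF Y \<open>0 < \<epsilon>'\<close>] by blast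
  \<comment> \<open>The bound \<open>d\<close> makes stability applicable; \<open>e / L\<close> then
    keeps each solution within \<open>e\<close> of \<open>Y\<close>, where the linearization is
    valid.\<close>
  define \<delta> where "\<delta> = min d (e / L)"
  define R where "R Z s = V (Z s) - V (Y s) - A (Y s) (Z s - Y s)" for Z s
  have R: "norm (R Z s) \<le> \<epsilon>' * L * norm (Z 0 - Y 0)"
    if "solution V Z" "norm (Z 0 - Y 0) < \<delta>" "0 \<le> s" "s \<le> t" for Z s
  proof -
    have le: "norm (Z s - Y s) \<le> L * norm (Z 0 - Y 0)"
      using st that by (simp add: \<delta>_def)
    also have "\<dots> < e" using that \<open>0 < L\<close> by (simp add: \<delta>_def field_simps)
    finally have "norm (R Z s) \<le> \<epsilon>' * norm (Z s - Y s)"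
      unfolding R_def using e that by blast
    also have "\<dots> \<le> \<epsilon>' * (L * norm (Z 0 - Y 0))"
      using le \<open>0 < \<epsilon>'\<close> by (intro mult_left_mono) auto
    finally show ?thesis by (simp add: mult.assoc)
  qed
  show ?thesis
  proof
    show "0 < \<delta>" using \<open>0 < d\<close> \<open>0 < e\<close> \<open>0 < L\<close> by (simp add: \<delta>_def)
    fix Z1 Z2 Z3 :: "real \<Rightarrow> 'a" and c :: real
    assume Z: "solution V Z1" "solution V Z2" "solution V Z3"
      and close: "norm (Z1 0 - Y 0) < \<delta>" "norm (Z2 0 - Y 0) < \<delta>" "norm (Z3 0 - Y 0) < \<delta>"
      and init: "Z1 0 - Y 0 = c *\<^sub>R (Z2 0 - Y 0) + (Z3 0 - Y 0)"
    define E where "E s = (Z1 s - Y s) - (c *\<^sub>R (Z2 s - Y s) + (Z3 s - Y s))" for s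
    define N where "N = norm (Z1 0 - Y 0) + \<bar>c\<bar> * norm (Z2 0 - Y 0) + norm (Z3 0 - Y 0)"
    define E' where "E' s = (V (Z1 s) - V (Y s)) - (c *\<^sub>R (V (Z2 s) - V (Y s)) + (V (Z3 s) - V (Y s)))"
      for s
    have E0: "E 0 = 0" using init by (simp add: E_def)
    have "norm (E t) \<le> (norm (E 0) + \<epsilon>' * L * N) * exp ((K + 1) * t)"
    proof (rule gronwall_norm[where E' = E'])
      show "(E has_vector_derivative E' s) (at s)" for s
        using Y Z unfolding solution_def E_def E'_def
        by (auto intro!: derivative_eq_intros)
      fix s assume s: "0 < s" "s < t"
      \<comment> \<open>By linearity of \<open>A (Y s)\<close> the linear parts recombine to
        \<open>E s\<close>, leaving only the remainders as forcing.\<close>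
      have eq: "E' s = A (Y s) (E s) + (R Z1 s - (c *\<^sub>R R Z2 s + R Z3 s))"
        unfolding E'_def E_def R_def by (simp add: blinfun.bilinear_simps algebra_simps)
      have "norm (R Z1 s - (c *\<^sub>R R Z2 s + R Z3 s))
          \<le> norm (R Z1 s) + (\<bar>c\<bar> * norm (R Z2 s) + norm (R Z3 s))"
        by (metis norm_triangle_le_diff norm_triangle_ineq norm_scaleR add_left_mono)
      also have "\<dots> \<le> \<epsilon>' * L * norm (Z1 0 - Y 0)
          + (\<bar>c\<bar> * (\<epsilon>' * L * norm (Z2 0 - Y 0)) + \<epsilon>' * L * norm (Z3 0 - Y 0))"
        using s by (intro add_mono mult_left_mono R Z close) auto
      also have "\<dots> = \<epsilon>' * L * N" by (simp add: N_def algebra_simps)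
      finally show "norm (E' s) \<le> K * norm (E s) + \<epsilon>' * L * N"
        unfolding eq using K(2)[of s "E s"] s by (intro norm_triangle_mono) auto
    qed (use K \<open>0 < \<epsilon>'\<close> \<open>0 < L\<close> \<open>0 \<le> t\<close> in \<open>auto simp: N_def\<close>)
    also have "\<dots> = \<epsilon> * N" using \<open>0 < L\<close> by (simp add: \<epsilon>'_def E0)
    finally show "norm ((Z1 t - Y t) - (c *\<^sub>R (Z2 t - Y t) + (Z3 t - Y t)))
        \<le> \<epsilon> * (norm (Z1 0 - Y 0) + \<bar>c\<bar> * norm (Z2 0 - Y 0) + norm (Z3 0 - Y 0))"
      by (simp add: E_def N_def)
  qed
qed

end

section \<open>The flow\<close>

text \<open>The derivative is obtained as the limit of difference quotients, which exists by
  completeness because almost linearity under scaling makes them a Cauchy sequence.\<close>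

lemma almost_linear_imp_differentiable:
  fixes f :: "'a::euclidean_space \<Rightarrow> 'b::banach"
  assumes "\<And>\<epsilon>. 0 < \<epsilon> \<Longrightarrow> \<exists>\<delta>>0. \<forall>c h k. norm (c *\<^sub>R h + k) < \<delta> \<longrightarrow> norm h < \<delta> \<longrightarrow> norm k < \<delta> \<longrightarrow>
    norm ((f (x + (c *\<^sub>R h + k)) - f x) - (c *\<^sub>R (f (x + h) - f x) + (f (x + k) - f x)))
      \<le> \<epsilon> * (norm (c *\<^sub>R h + k) + \<bar>c\<bar> * norm h + norm k)"
  shows "f differentiable (at x)"
proof -
  define D where "D h = f (x + h) - f x" for h
  define r where "r n = inverse (real (Suc n))" for n
  define Q where "Q n h = inverse (r n) *\<^sub>R D (r n *\<^sub>R h)" for n h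
  have r: "0 < r n" "r n \<le> 1" "r \<longlonglongrightarrow> 0" for n
    using LIMSEQ_inverse_real_of_nat unfolding r_def[abs_def] by (auto simp: field_simps simp del: of_nat_Suc)
  have unscale: "norm (inverse s *\<^sub>R w) \<le> b" if "norm w \<le> s * b" "0 < s" for s b and w :: 'b
    using that by (simp add: divide_inverse[symmetric] field_simps)
  have D0: "D 0 = 0" by (simp add: D_def)
  have lin: "\<exists>\<delta>>0. \<forall>c h k. norm (c *\<^sub>R h + k) < \<delta> \<longrightarrow> norm h < \<delta> \<longrightarrow> norm k < \<delta> \<longrightarrow>
      norm (D (c *\<^sub>R h + k) - (c *\<^sub>R D h + D k)) \<le> \<epsilon> * (norm (c *\<^sub>R h + k) + \<bar>c\<bar> * norm h + norm k)"
    if "0 < \<epsilon>" for \<epsilon>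
    using assms[OF that] by (simp add: D_def)
  have small: "\<exists>N. \<forall>n\<ge>N. norm (r n *\<^sub>R h) < \<delta>" if "0 < \<delta>" for \<delta> and h :: 'a
  proof -
    have "(\<lambda>n. r n *\<^sub>R h) \<longlonglongrightarrow> 0 *\<^sub>R h" by (intro tendsto_intros r)
    then show ?thesis using that by (auto simp: LIMSEQ_iff)
  qed
  \<comment> \<open>The radius is independent of \<open>s\<close>. This uniformity yields both the
    Cauchy property and, as \<open>s\<close> tends to 0, the final remainder estimate.\<close>
  have scale: "\<exists>\<delta>>0. \<forall>h s. norm h < \<delta> \<longrightarrow> 0 < s \<longrightarrow> s *\<^sub>R norm h < \<delta> \<longrightarrow>
      norm (inverse s *\<^sub>R D (s *\<^sub>R h) - D h) \<le> \<epsilon> * norm h" if eps: "0 < \<epsilon>" for \<epsilon>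
  proof -
    \<comment> \<open>For \<open>c = s\<close> and \<open>k = 0\<close> the bracket equals
      \<open>2 s |h|\<close>, hence half of \<open>\<epsilon>\<close>.\<close>
    obtain \<delta> where "0 < \<delta>" and \<delta>: "\<And>c h k. norm (c *\<^sub>R h + k) < \<delta> \<Longrightarrow> norm h < \<delta> \<Longrightarrow> norm k < \<delta> \<Longrightarrow>
      norm (D (c *\<^sub>R h + k) - (c *\<^sub>R D h + D k)) \<le> \<epsilon> / 2 * (norm (c *\<^sub>R h + k) + \<bar>c\<bar> * norm h + norm k)"
      using lin[OF half_gt_zero[OF eps]] by blast
    have "norm (inverse s *\<^sub>R D (s *\<^sub>R h) - D h) \<le> \<epsilon> * norm h"
      if "norm h < \<delta>" "0 < s" "s *\<^sub>R norm h < \<delta>" for h s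
    proof -
      have "norm (D (s *\<^sub>R h) - s *\<^sub>R D h) \<le> s * (\<epsilon> * norm h)"
        using \<delta>[of s h 0] that \<open>0 < \<delta>\<close> by (simp add: D0 mult.left_commute)
      moreover have "inverse s *\<^sub>R D (s *\<^sub>R h) - D h = inverse s *\<^sub>R (D (s *\<^sub>R h) - s *\<^sub>R D h)"
        using \<open>0 < s\<close> by (simp add: algebra_simps)
      ultimately show ?thesis
        using \<open>0 < s\<close> by (simp only: unscale)
    qed
    with \<open>0 < \<delta>\<close> show ?thesis by blast
  qed
  have "Cauchy (\<lambda>n. Q n h)" for h
  proof (rule metric_CauchyI)
    fix e :: real assume "0 < e"
    \<comment> \<open>The added 1 covers \<open>h = 0\<close>.\<close>
    define \<epsilon> where "\<epsilon> = e / (norm h + 1)"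
    have \<epsilon>: "0 < \<epsilon>" "\<epsilon> * norm h < e"
      using \<open>0 < e\<close> by (auto simp: \<epsilon>_def field_simps add_pos_nonneg)
    obtain \<delta> where "0 < \<delta>" and \<delta>: "\<And>h s. norm h < \<delta> \<Longrightarrow> 0 < s \<Longrightarrow> s *\<^sub>R norm h < \<delta> \<Longrightarrow>
        norm (inverse s *\<^sub>R D (s *\<^sub>R h) - D h) \<le> \<epsilon> * norm h"
      using scale[OF \<epsilon>(1)] by blast
    obtain N where N: "\<And>n. n \<ge> N \<Longrightarrow> norm (r n *\<^sub>R h) < \<delta>"
      using small[OF \<open>0 < \<delta>\<close>] by meson
    have "dist (Q m h) (Q n h) < e" if "m \<ge> N" "n \<ge> N" for m n
    proof -
      \<comment> \<open>Comparing two scales is \<open>scale\<close> at the point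
        \<open>r n *\<^sub>R h\<close> with their ratio; dividing by \<open>r n\<close> leaves a
        bound free of \<open>m\<close> and \<open>n\<close>.\<close>
      define s where "s = r m / r n"
      have s: "0 < s" "s * r n = r m" using r(1)[of m] r(1)[of n] by (auto simp: s_def)
      have "norm (inverse s *\<^sub>R D (s *\<^sub>R r n *\<^sub>R h) - D (r n *\<^sub>R h)) \<le> \<epsilon> * norm (r n *\<^sub>R h)"
        using N[OF that(1)] N[OF that(2)] s r(1)[of n] r(1)[of m]
        by (intro \<delta>) (auto simp flip: mult.assoc)
      also have "inverse s *\<^sub>R D (s *\<^sub>R r n *\<^sub>R h) - D (r n *\<^sub>R h) = r n *\<^sub>R (Q m h - Q n h)"
        using s r(1)[of n] r(1)[of m] by (simp add: Q_def s_def algebra_simps divide_inverse)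
      finally have "norm (Q m h - Q n h) \<le> \<epsilon> * norm h"
        using r(1)[of n] by (simp add: mult.left_commute)
      then show ?thesis using \<epsilon> by (simp add: dist_norm)
    qed
    then show "\<exists>N. \<forall>m\<ge>N. \<forall>n\<ge>N. dist (Q m h) (Q n h) < e" by blast
  qed
  then have "\<exists>l. (\<lambda>n. Q n h) \<longlonglongrightarrow> l" for h
    by (simp add: Cauchy_convergent_iff convergent_def)
  then obtain L where L: "\<And>h. (\<lambda>n. Q n h) \<longlonglongrightarrow> L h" by metis
  \<comment> \<open>On vectors scaled by \<open>r n\<close> the failure of linearity is at most
    \<open>r n * e\<close>, so the quotients fail by at most \<open>e\<close>, and this passes to
    the limit.\<close>
  have L_comb: "L (c *\<^sub>R h + k) = c *\<^sub>R L h + L k" for c h k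
  proof -
    define M where "M = norm (c *\<^sub>R h + k) + \<bar>c\<bar> * norm h + norm k"
    have lim: "(\<lambda>n. norm (Q n (c *\<^sub>R h + k) - (c *\<^sub>R Q n h + Q n k)))
        \<longlonglongrightarrow> norm (L (c *\<^sub>R h + k) - (c *\<^sub>R L h + L k))"
      by (intro tendsto_intros L)
    have "norm (L (c *\<^sub>R h + k) - (c *\<^sub>R L h + L k)) \<le> 0 + e" if "0 < e" for e
    proof -
      define \<epsilon> where "\<epsilon> = e / (M + 1)"
      have "0 \<le> M" by (simp add: M_def)
      then have \<epsilon>: "0 < \<epsilon>" "\<epsilon> * M \<le> e"
        using \<open>0 < e\<close> by (auto simp: \<epsilon>_def field_simps)
      obtain \<delta> where "0 < \<delta>" and \<delta>: "\<And>c h k. norm (c *\<^sub>R h + k) < \<delta> \<Longrightarrow> norm h < \<delta> \<Longrightarrow> norm k < \<delta> \<Longrightarrow>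
        norm (D (c *\<^sub>R h + k) - (c *\<^sub>R D h + D k)) \<le> \<epsilon> * (norm (c *\<^sub>R h + k) + \<bar>c\<bar> * norm h + norm k)"
        using lin[OF \<epsilon>(1)] by blast
      obtain N1 N2 N3 where
        N1: "\<And>n. n \<ge> N1 \<Longrightarrow> norm (r n *\<^sub>R (c *\<^sub>R h + k)) < \<delta>" and
        N2: "\<And>n. n \<ge> N2 \<Longrightarrow> norm (r n *\<^sub>R h) < \<delta>" and
        N3: "\<And>n. n \<ge> N3 \<Longrightarrow> norm (r n *\<^sub>R k) < \<delta>"
        using small[OF \<open>0 < \<delta>\<close>] by meson
      have "norm (Q n (c *\<^sub>R h + k) - (c *\<^sub>R Q n h + Q n k)) \<le> e" if "n \<ge> max N1 (max N2 N3)" for n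
      proof -
        have eq: "r n *\<^sub>R (c *\<^sub>R h + k) = c *\<^sub>R (r n *\<^sub>R h) + r n *\<^sub>R k"
          by (simp add: algebra_simps)
        have "norm (D (r n *\<^sub>R (c *\<^sub>R h + k)) - (c *\<^sub>R D (r n *\<^sub>R h) + D (r n *\<^sub>R k)))
            \<le> \<epsilon> * (norm (r n *\<^sub>R (c *\<^sub>R h + k)) + \<bar>c\<bar> * norm (r n *\<^sub>R h) + norm (r n *\<^sub>R k))"
          unfolding eq using N1[of n] N2[of n] N3[of n] that by (intro \<delta>) (auto simp: eq)
        also have "\<dots> = r n * (\<epsilon> * M)"
          using r(1)[of n] by (simp add: M_def distrib_left ac_simps)
        also have "\<dots> \<le> r n * e" using \<epsilon>(2) r(1)[of n] by (intro mult_left_mono) auto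
        finally have "norm (D (r n *\<^sub>R (c *\<^sub>R h + k)) - (c *\<^sub>R D (r n *\<^sub>R h) + D (r n *\<^sub>R k))) \<le> r n * e" .
        moreover have "Q n (c *\<^sub>R h + k) - (c *\<^sub>R Q n h + Q n k)
            = inverse (r n) *\<^sub>R (D (r n *\<^sub>R (c *\<^sub>R h + k)) - (c *\<^sub>R D (r n *\<^sub>R h) + D (r n *\<^sub>R k)))"
          unfolding Q_def by (simp only: scaleR_diff_right scaleR_add_right scaleR_scaleR mult.commute)
        ultimately show ?thesis using r(1)[of n] by (simp only: unscale)
      qed
      then have "\<exists>N. \<forall>n\<ge>N. norm (Q n (c *\<^sub>R h + k) - (c *\<^sub>R Q n h + Q n k)) \<le> e"
        by blast
      then show ?thesis using LIMSEQ_le_const2[OF lim] by simp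
    qed
    then have "norm (L (c *\<^sub>R h + k) - (c *\<^sub>R L h + L k)) \<le> 0" by (rule field_le_epsilon)
    then show ?thesis by simp
  qed
  \<comment> \<open>Additivity is the case \<open>c = 1\<close>; homogeneity is the case
    \<open>k = 0\<close>, which uses \<open>L 0 = 0\<close>.\<close>
  have "L 0 = 0" using L[of 0] by (simp add: Q_def D0 LIMSEQ_const_iff)
  then have "linear L"
    using L_comb[of 1] L_comb[of _ _ 0] by (intro linearI) auto
  moreover have "\<exists>\<delta>>0. \<forall>h. norm h < \<delta> \<longrightarrow> norm (D h - L h) \<le> \<epsilon> * norm h" if eps: "0 < \<epsilon>" for \<epsilon>
  proof -
    obtain \<delta> where "0 < \<delta>" and \<delta>: "\<And>h s. norm h < \<delta> \<Longrightarrow> 0 < s \<Longrightarrow> s *\<^sub>R norm h < \<delta> \<Longrightarrow>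
        norm (inverse s *\<^sub>R D (s *\<^sub>R h) - D h) \<le> \<epsilon> * norm h"
      using scale[OF eps] by blast
    have "norm (D h - L h) \<le> \<epsilon> * norm h" if "norm h < \<delta>" for h
    proof -
      \<comment> \<open>Here \<open>s = r n \<le> 1\<close>, so one bound on \<open>norm h\<close>
        serves for every \<open>n\<close> and survives the limit.\<close>
      have "(\<lambda>n. norm (Q n h - D h)) \<longlonglongrightarrow> norm (L h - D h)"
        by (intro tendsto_intros L)
      moreover have "norm (Q n h - D h) \<le> \<epsilon> * norm h" for n
      proof -
        have "r n *\<^sub>R norm h < \<delta>"
          using r(1,2)[of n] mult_left_le_one_le[of "norm h" "r n"] that by simp
        then show ?thesis unfolding Q_def using that r(1)[of n] by (intro \<delta>)
      qed
      ultimately have "norm (L h - D h) \<le> \<epsilon> * norm h"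
        by (intro LIMSEQ_le_const2) auto
      then show ?thesis by (simp add: norm_minus_commute)
    qed
    with \<open>0 < \<delta>\<close> show ?thesis by blast
  qed
  moreover have "f y - f x = D (y - x)" for y
    by (simp add: D_def)
  ultimately have "(f has_derivative L) (at x)"
    unfolding has_derivative_at_alt linear_conv_bounded_linear by metis
  then show ?thesis by (rule differentiableI)
qed

locale C1_flow = C1_field V A
  for V :: "real^'n \<Rightarrow> real^'n" and A +
  fixes \<phi> :: "real \<Rightarrow> real^'n \<Rightarrow> real^'n"
  assumes global_flow: "is_global_flow V \<phi>"
begin

lemma flow_0 [simp]: "\<phi> 0 x = x"
  using global_flow by (simp add: is_global_flow_def)

lemma flow_solution: "solution V (\<lambda>s. \<phi> s x)"
  using global_flow by (simp add: is_global_flow_def solution_def)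

text \<open>This carries uniqueness and differentiability from nonnegative to negative
  times.\<close>

lemma reverse_flow: "C1_flow (\<lambda>x. - V x) (\<lambda>x. - A x) (\<lambda>s. \<phi> (- s))"
proof -
  interpret R: C1_field "\<lambda>x. - V x" "\<lambda>x. - A x"
    by (rule reverse)
  have "is_global_flow (\<lambda>x. - V x) (\<lambda>s. \<phi> (- s))"
    unfolding is_global_flow_def
  proof (intro allI conjI)
    show "\<phi> (- 0) x = x" for x by simp
    show "((\<lambda>s. \<phi> (- s) x) has_vector_derivative - V (\<phi> (- t) x)) (at t)" for x t
      using solution_reverse[OF flow_solution[of x]] unfolding solution_def by blast
  qed
  then show ?thesis by unfold_locales
qed

section \<open>Uniqueness, group law and differentiability of the flow\<close>

lemma solution_eq_flow_forward:
  assumes "solution V Y" "0 \<le> t"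
  shows "Y t = \<phi> t (Y 0)"
  by (rule solution_unique_forward[OF assms(1) flow_solution _ assms(2)]) simp

lemma solution_eq_flow:
  assumes "solution V Y"
  shows "Y t = \<phi> t (Y 0)"
proof (cases "0 \<le> t")
  case False
  interpret R: C1_flow "\<lambda>x. - V x" "\<lambda>x. - A x" "\<lambda>s. \<phi> (- s)"
    by (rule reverse_flow)
  show ?thesis
    using R.solution_eq_flow_forward[OF solution_reverse[OF assms], of "- t"] False by simp
qed (use solution_eq_flow_forward assms in blast)

lemma flow_add: "\<phi> (s + t) x = \<phi> s (\<phi> t x)"
  using solution_eq_flow[OF solution_shift[OF flow_solution, of t x], of s] by simp

lemma flow_inverse [simp]: "\<phi> t (\<phi> (- t) x) = x" "\<phi> (- t) (\<phi> t x) = x"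
  using flow_add[of t "- t" x] flow_add[of "- t" t x] by simp_all

text \<open>Links the abstract inverse in the pulled-back velocity to the flow, whose
  differentiability then applies to it.\<close>

lemma inv_flow: "inv (\<phi> t) = \<phi> (- t)"
  by (rule inv_unique_comp) (auto simp: fun_eq_iff)

text \<open>Trajectories issuing from \<open>x + (c h + k)\<close>, \<open>x + h\<close> and
  \<open>x + k\<close> turn \<open>deviation_almost_linear\<close> into the hypothesis of
  \<open>almost_linear_imp_differentiable\<close>.\<close>

lemma flow_differentiable_forward:
  assumes "0 \<le> t"
  shows "\<phi> t differentiable (at x)"
proof (rule almost_linear_imp_differentiable)
  fix \<epsilon> :: real assume "0 < \<epsilon>"
  obtain \<delta> where "0 < \<delta>" and \<delta>:
    "\<And>Z1 Z2 Z3 c. solution V Z1 \<Longrightarrow> solution V Z2 \<Longrightarrow> solution V Z3 \<Longrightarrow>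
      norm (Z1 0 - \<phi> 0 x) < \<delta> \<Longrightarrow> norm (Z2 0 - \<phi> 0 x) < \<delta> \<Longrightarrow> norm (Z3 0 - \<phi> 0 x) < \<delta> \<Longrightarrow>
      Z1 0 - \<phi> 0 x = c *\<^sub>R (Z2 0 - \<phi> 0 x) + (Z3 0 - \<phi> 0 x) \<Longrightarrow>
      norm ((Z1 t - \<phi> t x) - (c *\<^sub>R (Z2 t - \<phi> t x) + (Z3 t - \<phi> t x)))
        \<le> \<epsilon> * (norm (Z1 0 - \<phi> 0 x) + \<bar>c\<bar> * norm (Z2 0 - \<phi> 0 x) + norm (Z3 0 - \<phi> 0 x))"
    using deviation_almost_linear[OF flow_solution[of x] assms \<open>0 < \<epsilon>\<close>] by blast
  show "\<exists>\<delta>>0. \<forall>c h k. norm (c *\<^sub>R h + k) < \<delta> \<longrightarrow> norm h < \<delta> \<longrightarrow> norm k < \<delta> \<longrightarrow>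
    norm ((\<phi> t (x + (c *\<^sub>R h + k)) - \<phi> t x) - (c *\<^sub>R (\<phi> t (x + h) - \<phi> t x) + (\<phi> t (x + k) - \<phi> t x)))
      \<le> \<epsilon> * (norm (c *\<^sub>R h + k) + \<bar>c\<bar> * norm h + norm k)"
    using \<delta>[OF flow_solution flow_solution flow_solution] \<open>0 < \<delta>\<close>
    by (intro exI[of _ \<delta>]) (metis add_diff_cancel_left' flow_0)
qed

lemma flow_differentiable: "\<phi> t differentiable (at x)"
proof (cases "0 \<le> t")
  case False
  interpret R: C1_flow "\<lambda>x. - V x" "\<lambda>x. - A x" "\<lambda>s. \<phi> (- s)"
    by (rule reverse_flow)
  show ?thesis using R.flow_differentiable_forward[of "- t" x] False by simp
qed (rule flow_differentiable_forward)

lemma flow_continuous: "continuous_on S (\<phi> t)"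
  by (intro continuous_at_imp_continuous_on ballI differentiable_imp_continuous_within
      flow_differentiable)

section \<open>Topology of the moving domain\<close>

lemma moving_domain_iff: "y \<in> moving_domain \<phi> \<Omega> t \<longleftrightarrow> \<phi> (- t) y \<in> \<Omega>"
  unfolding moving_domain_def image_iff by (metis flow_inverse)

lemma open_moving_domain:
  assumes "open \<Omega>" shows "open (moving_domain \<phi> \<Omega> t)"
proof -
  have "moving_domain \<phi> \<Omega> t = \<phi> (- t) -` \<Omega>" by (auto simp: moving_domain_iff)
  then show ?thesis using open_vimage[OF assms flow_continuous] by simp
qed

text \<open>Each \<open>\<phi> t\<close> is a homeomorphism of the whole space; this matches the two
  boundary conditions.\<close>

lemma frontier_moving_domain: "frontier (moving_domain \<phi> \<Omega> t) = \<phi> t ` frontier \<Omega>"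
proof -
  have "homeomorphic_maps euclidean euclidean (\<phi> t) (\<phi> (- t))"
    by (simp add: homeomorphic_maps_def flow_continuous)
  then show ?thesis
    using homeomorphic_map_frontier_of[of euclidean euclidean "\<phi> t" \<Omega>]
    by (auto simp: homeomorphic_map_maps moving_domain_def frontier_of_def frontier_def)
qed

text \<open>The time derivative at a fixed \<open>y\<close> takes values of \<open>T\<close> at that
  \<open>y\<close> for nearby times, so \<open>y\<close> has to remain in the domain for a
  while.\<close>

lemma eventually_in_moving_domain:
  assumes "open \<Omega>" "y \<in> moving_domain \<phi> \<Omega> t"
  shows "\<forall>\<^sub>F s in at t within S. y \<in> moving_domain \<phi> \<Omega> s"
proof -
  have "continuous_on UNIV (\<lambda>s. \<phi> (- s) y)"
    by (intro continuous_on_compose2[OF solution_continuous[OF flow_solution]] continuous_intros)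
      auto
  then have "((\<lambda>s. \<phi> (- s) y) \<longlongrightarrow> \<phi> (- t) y) (at t within S)"
    by (metis UNIV_I continuous_on tendsto_within_subset subset_UNIV)
  then show ?thesis
    using topological_tendstoD[of _ _ _ \<Omega>] assms by (auto simp: moving_domain_iff)
qed

end

section \<open>Transport along the flow\<close>

lemma gradient_inner:
  fixes u :: "real^'n \<Rightarrow> real"
  assumes "(u has_derivative u') (at y)"
  shows "gradient u y \<bullet> v = u' v"
proof -
  have "linear u'" using assms by (rule has_derivative_linear)
  have "u' v = u' (\<Sum>i\<in>UNIV. v $ i *\<^sub>R axis i 1)"
    using basis_expansion[of v] by (simp add: scalar_mult_eq_scaleR)
  also have "\<dots> = (\<Sum>i\<in>UNIV. v $ i * u' (axis i 1))"
    by (simp add: linear_sum[OF \<open>linear u'\<close>] linear_scale[OF \<open>linear u'\<close>])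
  finally show ?thesis
    by (simp add: inner_vec_def gradient_def frechet_derivative_at[OF assms, symmetric] mult.commute)
qed

lemma divergence_eq:
  assumes "(F has_derivative F') (at y)"
  shows "divergence F y = (\<Sum>i\<in>UNIV. F' (axis i 1) $ i)"
  by (simp add: divergence_def jacobian_def trace_def matrix_def
      frechet_derivative_at[OF assms, symmetric])

text \<open>Serves twice: with \<open>F = a\<close> for the flux, and with \<open>F = V\<close> for
  the transport term.\<close>

lemma divergence_scaleR:
  assumes "u differentiable (at y)" "F differentiable (at y)"
  shows "divergence (\<lambda>z. u z *\<^sub>R F z) y = gradient u y \<bullet> F y + divergence F y * u y"
proof -
  obtain u' F' where u': "(u has_derivative u') (at y)" and F': "(F has_derivative F') (at y)"
    using assms by (auto simp: differentiable_def)
  have "((\<lambda>z. u z *\<^sub>R F z) has_derivative (\<lambda>h. u y *\<^sub>R F' h + u' h *\<^sub>R F y)) (at y)"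
    by (rule has_derivative_scaleR[OF u' F'])
  then have "divergence (\<lambda>z. u z *\<^sub>R F z) y
      = (\<Sum>i\<in>UNIV. u y * F' (axis i 1) $ i) + (\<Sum>i\<in>UNIV. u' (axis i 1) * F y $ i)"
    by (simp add: divergence_eq sum.distrib)
  also have "(\<Sum>i\<in>UNIV. u' (axis i 1) * F y $ i) = gradient u y \<bullet> F y"
    by (simp add: inner_vec_def gradient_def frechet_derivative_at[OF u', symmetric])
  finally show ?thesis
    by (simp add: divergence_eq[OF F'] sum_distrib_left mult.commute)
qed

text \<open>The flux law is assumed only inside the moving domain; since that set is open, it may be
  used under the divergence.\<close>

lemma divergence_cong_open:
  assumes "open S" "y \<in> S" "\<And>z. z \<in> S \<Longrightarrow> F z = G z"
  shows "divergence F y = divergence G y"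
proof -
  have "(F has_derivative D) (at y) \<longleftrightarrow> (G has_derivative D) (at y)" for D
    using has_derivative_transform_within_open[OF _ assms(1,2), of F D UNIV G]
      has_derivative_transform_within_open[OF _ assms(1,2), of G D UNIV F] assms(3) by auto
  then show ?thesis by (simp add: divergence_def jacobian_def frechet_derivative_def)
qed

text \<open>Nontriviality of this filter makes the derivative unique, so that
  \<open>vector_derivative\<close> can be evaluated, at time 0 as well.\<close>

lemma at_within_atLeast_neq_bot:
  fixes t :: real assumes "0 \<le> t" shows "at t within {0..} \<noteq> bot"
proof -
  have "at_right t \<le> at t within {0..}" using assms by (intro at_le) auto
  then show ?thesis by (metis bot.extremum_unique trivial_limit_at_right_real)
qed

section \<open>Chain rules along the flow\<close>

context C1_flow
begin

text \<open>Here \<open>g'\<close> is the derivative of a local smooth extension of \<^term>\<open>T\<close> to negative times and past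
  the boundary; \<^term>\<open>T\<close> itself need not be differentiable at time \<open>0\<close>.\<close>

lemma spacetime_derivative:
  fixes T :: "real^'n \<Rightarrow> real \<Rightarrow> real"
  assumes smooth: "smooth_on {(y, t). 0 \<le> t \<and> y \<in> closure (moving_domain \<phi> \<Omega> t)} (\<lambda>(y, t). T y t)"
    and "open \<Omega>" "0 \<le> t" and y: "y \<in> moving_domain \<phi> \<Omega> t"
  obtains g' :: "(real^'n) \<times> real \<Rightarrow> real" where "linear g'"
    and "((\<lambda>z. T z t) has_derivative (\<lambda>h. g' (h, 0))) (at y)"
    and "\<And>\<gamma> v. (\<gamma> has_vector_derivative v) (at t) \<Longrightarrow> \<gamma> t = y \<Longrightarrow>
      \<forall>\<^sub>F s in at t within {0..}. \<gamma> s \<in> moving_domain \<phi> \<Omega> s \<Longrightarrow>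
      vector_derivative (\<lambda>s. T (\<gamma> s) s) (at t within {0..}) = g' (v, 1)"
proof -
  define S where "S = {(y, t). 0 \<le> t \<and> y \<in> closure (moving_domain \<phi> \<Omega> t)}"
  have in_S: "(z, s) \<in> S" if "0 \<le> s" "z \<in> moving_domain \<phi> \<Omega> s" for z s
    using that closure_subset by (auto simp: S_def)
  obtain U g where U: "open U" "(y, t) \<in> U"
    and smooth_g: "\<And>k. higher_differentiable_on U g k"
    and eq: "\<And>q. q \<in> S \<inter> U \<Longrightarrow> g q = (case q of (y, t) \<Rightarrow> T y t)"
    using smooth in_S[OF \<open>0 \<le> t\<close> y] unfolding smooth_on_def S_def by meson
  have "g differentiable (at (y, t))"
    using smooth_g[of 1] U by simp
  then obtain g' where g': "(g has_derivative g') (at (y, t))"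
    by (auto simp: differentiable_def)
  show ?thesis
  proof
    show "linear g'" using g' by (rule has_derivative_linear)
    have "((\<lambda>z. g (z, t)) has_derivative (\<lambda>h. g' (h, 0))) (at y)"
      by (rule has_derivative_compose[where f = "\<lambda>z. (z, t)" and g = g])
        (auto intro!: derivative_eq_intros g')
    then show "((\<lambda>z. T z t) has_derivative (\<lambda>h. g' (h, 0))) (at y)"
    proof (rule has_derivative_transform_within_open)
      \<comment> \<open>The time slice of \<open>U\<close> meets the moving domain in an open set on
        which \<open>g\<close> and \<open>T\<close> agree.\<close>
      have "open ((\<lambda>z. (z, t)) -` U)"
        by (intro open_vimage U continuous_intros)
      then show "open (moving_domain \<phi> \<Omega> t \<inter> (\<lambda>z. (z, t)) -` U)"
        using open_moving_domain[OF \<open>open \<Omega>\<close>] by blast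
    qed (use U y eq in_S \<open>0 \<le> t\<close> in auto)
    fix \<gamma> :: "real \<Rightarrow> real^'n" and v
    assume \<gamma>: "(\<gamma> has_vector_derivative v) (at t)" "\<gamma> t = y"
      and inside: "\<forall>\<^sub>F s in at t within {0..}. \<gamma> s \<in> moving_domain \<phi> \<Omega> s"
    have pair: "((\<lambda>s. (\<gamma> s, s)) has_vector_derivative (v, 1)) (at t within {0..})"
      by (intro has_vector_derivative_Pair has_vector_derivative_at_within[OF \<gamma>(1)]
          has_vector_derivative_id)
    then have "((\<lambda>s. (\<gamma> s, s)) \<longlongrightarrow> (y, t)) (at t within {0..})"
      using has_vector_derivative_continuous[OF pair] \<gamma>(2) by (simp add: continuous_within)
    then have near: "\<forall>\<^sub>F s in at t within {0..}. (\<gamma> s, s) \<in> U"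
      using U topological_tendstoD by blast
    have "((\<lambda>s. g (\<gamma> s, s)) has_vector_derivative g' (v, 1)) (at t within {0..})"
      using vector_derivative_diff_chain_within[OF pair, of g g'] g' \<gamma>(2)
      by (simp add: o_def has_derivative_at_withinI)
    then have "((\<lambda>s. T (\<gamma> s) s) has_vector_derivative g' (v, 1)) (at t within {0..})"
      unfolding has_vector_derivative_def
    proof (rule has_derivative_transform_eventually)
      have "\<forall>\<^sub>F s in at t within {0..}. s \<in> {0..}" by (simp add: eventually_at_filter)
      with inside near show "\<forall>\<^sub>F s in at t within {0..}. g (\<gamma> s, s) = T (\<gamma> s) s"
        by eventually_elim (simp add: eq in_S)
    qed (use U y eq in_S \<open>0 \<le> t\<close> \<gamma>(2) in auto)
    then show "vector_derivative (\<lambda>s. T (\<gamma> s) s) (at t within {0..}) = g' (v, 1)"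
      by (rule vector_derivative_within[OF at_within_atLeast_neq_bot[OF \<open>0 \<le> t\<close>]])
  qed
qed

text \<open>The three terms are one linear map \<open>g'\<close> evaluated at \<open>(V, 1)\<close>
  along the trajectory, at \<open>(0, 1)\<close> along the constant curve and at
  \<open>(V, 0)\<close> in space; linearity adds them up.\<close>

lemma time_derivative_pullback:
  assumes "smooth_on {(y, t). 0 \<le> t \<and> y \<in> closure (moving_domain \<phi> \<Omega> t)} (\<lambda>(y, t). T y t)"
    and "open \<Omega>" "0 \<le> t" "x \<in> \<Omega>"
  shows "time_derivative (pullback \<phi> T) x t
    = time_derivative T (\<phi> t x) t + gradient (\<lambda>z. T z t) (\<phi> t x) \<bullet> V (\<phi> t x)"
proof -
  have y: "\<phi> s x \<in> moving_domain \<phi> \<Omega> s" for s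
    using \<open>x \<in> \<Omega>\<close> by (simp add: moving_domain_def)
  obtain g' :: "(real^'n) \<times> real \<Rightarrow> real" where "linear g'"
    and space: "((\<lambda>z. T z t) has_derivative (\<lambda>h. g' (h, 0))) (at (\<phi> t x))"
    and curve: "\<And>\<gamma> v. (\<gamma> has_vector_derivative v) (at t) \<Longrightarrow> \<gamma> t = \<phi> t x \<Longrightarrow>
      \<forall>\<^sub>F s in at t within {0..}. \<gamma> s \<in> moving_domain \<phi> \<Omega> s \<Longrightarrow>
      vector_derivative (\<lambda>s. T (\<gamma> s) s) (at t within {0..}) = g' (v, 1)"
    using spacetime_derivative[OF assms(1-3) y[of t]] by blast
  have "time_derivative (pullback \<phi> T) x t = g' (V (\<phi> t x), 1)"
    unfolding time_derivative_def pullback_def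
    using flow_solution[of x] by (intro curve) (auto simp: solution_def y)
  moreover have "time_derivative T (\<phi> t x) t = g' (0, 1)"
    unfolding time_derivative_def
    by (intro curve has_vector_derivative_const refl eventually_in_moving_domain assms y)
  moreover have "gradient (\<lambda>z. T z t) (\<phi> t x) \<bullet> V (\<phi> t x) = g' (V (\<phi> t x), 0)"
    by (rule gradient_inner[OF space])
  ultimately show ?thesis
    using linear_add[OF \<open>linear g'\<close>, of "(0, 1)" "(V (\<phi> t x), 0)"] by simp
qed

text \<open>Differentiating \<open>\<phi> t (\<phi> (- t) y) = y\<close> shows that the derivative
  of \<open>\<phi> t\<close> undoes the Jacobian of the inverse flow, so only the action of the
  gradient of \<open>T\<close> on \<open>a\<close> remains.\<close>

lemma gradient_pullback_inner:
  assumes "(\<lambda>z. T z t) differentiable (at (\<phi> t x))"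
  shows "gradient (\<lambda>z. pullback \<phi> T z t) x \<bullet> pulled_back_velocity \<phi> a x t
    = gradient (\<lambda>z. T z t) (\<phi> t x) \<bullet> a (\<phi> t x) t"
proof -
  obtain T' where T': "((\<lambda>z. T z t) has_derivative T') (at (\<phi> t x))"
    using assms by (auto simp: differentiable_def)
  obtain D where D: "(\<phi> t has_derivative D) (at x)"
    using flow_differentiable by (auto simp: differentiable_def)
  let ?D' = "\<lambda>h. jacobian (\<phi> (- t)) (at (\<phi> t x)) *v h"
  have D': "(\<phi> (- t) has_derivative ?D') (at (\<phi> t x))"
    using flow_differentiable jacobian_works by blast
  have "((\<lambda>y. \<phi> t (\<phi> (- t) y)) has_derivative (\<lambda>h. D (?D' h))) (at (\<phi> t x))"
    by (rule has_derivative_compose[OF D']) (simp add: D)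
  then have "(\<lambda>h. D (?D' h)) = (\<lambda>h. h)"
    using has_derivative_unique has_derivative_ident by (simp, blast)
  moreover have "((\<lambda>z. pullback \<phi> T z t) has_derivative (\<lambda>h. T' (D h))) (at x)"
    unfolding pullback_def by (rule has_derivative_compose[OF D T'])
  ultimately show ?thesis
    by (simp add: gradient_inner[OF T'] gradient_inner pulled_back_velocity_def pullback_def
        inv_flow fun_eq_iff)
qed

end

theorem proposition5p3:
  fixes \<Omega>\<^sub>0 :: "(real^'n) set"
    and V :: "real^'n \<Rightarrow> real^'n"
    and \<phi> :: "real \<Rightarrow> real^'n \<Rightarrow> real^'n"
    and a J :: "real^'n \<Rightarrow> real \<Rightarrow> real^'n"
    and f T :: "real^'n \<Rightarrow> real \<Rightarrow> real"
    and T\<^sub>0 :: "real^'n \<Rightarrow> real"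
  assumes domain: "smooth_open_set \<Omega>\<^sub>0"
    and velocity: "smooth_on UNIV V"
    and flow: "is_global_flow V \<phi>"
    and a_C1: "higher_differentiable_on UNIV (\<lambda>(y, t). a y t) 1"
    and f_smooth: "smooth_on {(y, t). 0 \<le> t \<and> y \<in> moving_domain \<phi> \<Omega>\<^sub>0 t} (\<lambda>(y, t). f y t)"
    and T_smooth: "smooth_on {(y, t). 0 \<le> t \<and> y \<in> closure (moving_domain \<phi> \<Omega>\<^sub>0 t)} (\<lambda>(y, t). T y t)"
    and flux: "\<And>t y. 0 \<le> t \<Longrightarrow> y \<in> moving_domain \<phi> \<Omega>\<^sub>0 t \<Longrightarrow> J y t = T y t *\<^sub>R a y t"
  shows "(balance_problem \<phi> \<Omega>\<^sub>0 V f J T\<^sub>0 T \<longleftrightarrow> advection_problem \<phi> \<Omega>\<^sub>0 V f a T\<^sub>0 T) \<and>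
    (pulled_back_balance_problem \<phi> \<Omega>\<^sub>0 V f J T\<^sub>0 (pullback \<phi> T) \<longleftrightarrow>
       pulled_back_advection_problem \<phi> \<Omega>\<^sub>0 V f a T\<^sub>0 (pullback \<phi> T)) \<and>
    (advection_problem \<phi> \<Omega>\<^sub>0 V f a T\<^sub>0 T \<longleftrightarrow>
       pulled_back_advection_problem \<phi> \<Omega>\<^sub>0 V f a T\<^sub>0 (pullback \<phi> T))"
proof -
  obtain A :: "real^'n \<Rightarrow> (real^'n) \<Rightarrow>\<^sub>L (real^'n)"
    where "\<And>x. (V has_derivative A x) (at x)" "continuous_on UNIV A"
    using smooth_on_UNIV_imp_C1[OF velocity] by blast
  then interpret C1_flow V A \<phi>
    using flow by unfold_locales
  have "open \<Omega>\<^sub>0" using domain by (simp add: smooth_open_set_def)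
  have moving: "\<phi> t x \<in> moving_domain \<phi> \<Omega>\<^sub>0 t" if "x \<in> \<Omega>\<^sub>0" for t x
    using that by (simp add: moving_domain_def)
  have all_moving: "(\<forall>y\<in>moving_domain \<phi> \<Omega>\<^sub>0 t. P y) \<longleftrightarrow> (\<forall>x\<in>\<Omega>\<^sub>0. P (\<phi> t x))" for t P
    by (simp add: moving_domain_def)
  have T_diff: "(\<lambda>z. T z t) differentiable (at y)"
    if "0 \<le> t" "y \<in> moving_domain \<phi> \<Omega>\<^sub>0 t" for t y
    using spacetime_derivative[OF T_smooth \<open>open \<Omega>\<^sub>0\<close> that] by (metis differentiableI)
  have V_diff: "V differentiable (at y)" for y
    using field_derivative by (rule differentiableI)
  have a_diff: "(\<lambda>z. a z t) differentiable (at y)" for y t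
  proof -
    have "(\<lambda>(y, t). a y t) differentiable (at (y, t))" using a_C1 by simp
    moreover have "(\<lambda>z. (z, t)) differentiable (at y)"
      by (intro derivative_intros)
    ultimately show ?thesis
      using differentiable_chain_at[of "\<lambda>z. (z, t)" y "\<lambda>(y, t). a y t"] by (simp add: o_def)
  qed
  have div_J: "divergence (\<lambda>z. J z t) y
      = gradient (\<lambda>z. T z t) y \<bullet> a y t + divergence (\<lambda>z. a z t) y * T y t"
    if "0 \<le> t" "y \<in> moving_domain \<phi> \<Omega>\<^sub>0 t" for t y
  proof -
    have "divergence (\<lambda>z. J z t) y = divergence (\<lambda>z. T z t *\<^sub>R a z t) y"
      by (rule divergence_cong_open[OF open_moving_domain[OF \<open>open \<Omega>\<^sub>0\<close>] that(2)])
        (rule flux[OF that(1)])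
    then show ?thesis by (simp add: divergence_scaleR[OF T_diff[OF that] a_diff])
  qed
  have balance: "balance_problem \<phi> \<Omega>\<^sub>0 V f J T\<^sub>0 T \<longleftrightarrow> advection_problem \<phi> \<Omega>\<^sub>0 V f a T\<^sub>0 T"
    unfolding balance_problem_def advection_problem_def
    by (simp add: div_J algebra_simps cong: conj_cong)
  have grad: "gradient (\<lambda>z. pullback \<phi> T z t) x \<bullet> pulled_back_velocity \<phi> a x t
      = gradient (\<lambda>z. T z t) (\<phi> t x) \<bullet> a (\<phi> t x) t" if "0 \<le> t" "x \<in> \<Omega>\<^sub>0" for t x
    using T_diff[OF that(1) moving[OF that(2)]] by (rule gradient_pullback_inner)
  have pulled_back: "pulled_back_balance_problem \<phi> \<Omega>\<^sub>0 V f J T\<^sub>0 (pullback \<phi> T) \<longleftrightarrow>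
      pulled_back_advection_problem \<phi> \<Omega>\<^sub>0 V f a T\<^sub>0 (pullback \<phi> T)"
  proof -
    \<comment> \<open>The variable \<open>l\<close> stands for the time derivative shared by both
      equations; what remains is the expanded divergence of the flux at
      \<open>\<phi> t x\<close>.\<close>
    have "(l + pullback \<phi> T x t * pullback \<phi> (\<lambda>y s. divergence V y) x t
          = pullback \<phi> f x t - pullback \<phi> (\<lambda>y s. divergence (\<lambda>z. J z s) y) x t) \<longleftrightarrow>
        (l + pullback \<phi> T x t * reaction_coefficient \<phi> V a x t
          + gradient (\<lambda>z. pullback \<phi> T z t) x \<bullet> pulled_back_velocity \<phi> a x t = pullback \<phi> f x t)"
      if "0 \<le> t" "x \<in> \<Omega>\<^sub>0" for t x l
      unfolding grad[OF that] reaction_coefficient_def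
      by (simp add: pullback_def div_J that moving) (simp add: algebra_simps)
    then show ?thesis
      unfolding pulled_back_balance_problem_def pulled_back_advection_problem_def by simp
  qed
  have transport: "advection_problem \<phi> \<Omega>\<^sub>0 V f a T\<^sub>0 T \<longleftrightarrow>
      pulled_back_advection_problem \<phi> \<Omega>\<^sub>0 V f a T\<^sub>0 (pullback \<phi> T)"
  proof -
    \<comment> \<open>The left-hand sides agree at corresponding points, before any equation is
      imposed. In \<open>div (T V)\<close> the part with the gradient joins the material derivative,
      and the part \<open>T div V\<close> enters the reaction coefficient.\<close>
    have "time_derivative T (\<phi> t x) t + divergence (\<lambda>z. T z t *\<^sub>R V z) (\<phi> t x)
          + gradient (\<lambda>z. T z t) (\<phi> t x) \<bullet> a (\<phi> t x) t
          + divergence (\<lambda>z. a z t) (\<phi> t x) * T (\<phi> t x) t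
        = time_derivative (pullback \<phi> T) x t
          + pullback \<phi> T x t * reaction_coefficient \<phi> V a x t
          + gradient (\<lambda>z. pullback \<phi> T z t) x \<bullet> pulled_back_velocity \<phi> a x t"
      if "0 \<le> t" "x \<in> \<Omega>\<^sub>0" for t x
      unfolding grad[OF that] reaction_coefficient_def
        time_derivative_pullback[OF T_smooth \<open>open \<Omega>\<^sub>0\<close> that]
        divergence_scaleR[OF T_diff[OF that(1) moving[OF that(2)]] V_diff]
      by (simp add: pullback_def algebra_simps)
    \<comment> \<open>Boundary points correspond under \<open>\<phi> t\<close>, and
      \<open>\<phi> 0\<close> is the identity, which matches the initial conditions.\<close>
    then show ?thesis
      unfolding advection_problem_def pulled_back_advection_problem_def all_moving
        frontier_moving_domain
      by (simp add: pullback_def)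
  qed
  from balance pulled_back transport show ?thesis by blast
qed

end
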